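(* Let $f(x)\in\mathbb{Z}[x]$ be monic with $\deg f(x)=m$, suppose that at least one of the (complex) roots of $f(x)$ is not an integer, and let $q_1,q_2,\dots,q_m\in\mathbb{Z}$. Then the equation $$(y+q_1)(y+q_2)\cdots(y+q_m)=f(x)$$ has finitely many solutions $(x,y)$ in integers. *)

theory Defs
  imports Complex_Main "HOL-Computational_Algebra.Polynomial"
begin

end

theory Submission imports Defs begin

text \<open>
  Both sides are monic of degree \<open>m\<close>, and a monic polynomial \<open>p\<close> of degree \<open>m\<close> satisfies
  \<open>(\<bar>x\<bar> - K)^m \<le> \<bar>p x\<bar> \<le> (\<bar>x\<bar> + K)^m\<close> for large \<open>x\<close>. So \<open>\<bar>\<bar>x\<bar> - \<bar>y\<bar>\<bar>\<close> is bounded over all solutions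
  with \<open>x\<close> and \<open>y\<close> large, and \<open>y = s x + d\<close> with \<open>s = \<plusminus>1\<close> and finitely many values of \<open>d\<close>. For given
  \<open>s\<close> and \<open>d\<close>, infinitely many solutions would give the identity \<open>f(X) = (s X + d + q\<^sub>1) \<dots> (s X + d + q\<^sub>m)\<close>,
  so that all roots of \<open>f\<close> would be integers.
\<close>

lemma poly_map_poly_of_int:
  "poly (map_poly of_int p) (of_int x) = (of_int (poly p x) :: 'a::comm_ring_1)"
  by (induction p) (simp_all add: map_poly_pCons)

lemma finite_poly_eq:
  fixes p :: "'a::{comm_ring_1,ring_no_zero_divisors} poly"
  assumes "degree p > 0"
  shows "finite {x. poly p x = c}"
proof -
  have "p - [:c:] \<noteq> 0"
    using assms by auto
  then have "finite {x. poly (p - [:c:]) x = 0}"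
    by (rule poly_roots_finite)
  then show ?thesis
    by simp
qed

text \<open>Induction over the coefficients: for \<open>a + x * poly p x\<close> the factor
  \<open>x\<close> supplies one more power, and the new constant coefficient is absorbed by
  enlarging \<open>K\<close>.\<close>

lemma monic_poly_bounds:
  fixes p :: "'a::linordered_idom poly"
  assumes "lead_coeff p = 1"
  obtains K where "K \<ge> 0"
    and "\<And>x. \<bar>x\<bar> > K \<Longrightarrow>
      (\<bar>x\<bar> - K) ^ degree p \<le> \<bar>poly p x\<bar> \<and> \<bar>poly p x\<bar> \<le> (\<bar>x\<bar> + K) ^ degree p"
proof -
  have "\<exists>K\<ge>0. \<forall>x. \<bar>x\<bar> > K \<longrightarrow>
      (\<bar>x\<bar> - K) ^ degree p \<le> \<bar>poly p x\<bar> \<and> \<bar>poly p x\<bar> \<le> (\<bar>x\<bar> + K) ^ degree p"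
    using assms
  proof (induction p)
    case 0
    then show ?case by simp
  next
    case (pCons a p)
    show ?case
    proof (cases "p = 0")
      case True
      with pCons.prems show ?thesis by (auto intro: exI[of _ 0])
    next
      case False
      with pCons obtain K where "K \<ge> 0" and K: "\<And>x. \<bar>x\<bar> > K \<Longrightarrow>
          (\<bar>x\<bar> - K) ^ degree p \<le> \<bar>poly p x\<bar> \<and> \<bar>poly p x\<bar> \<le> (\<bar>x\<bar> + K) ^ degree p"
        by auto
      \<comment> \<open>The summand 1 makes the bases \<bar>x\<bar> - K and \<bar>x\<bar> + K at
        least 1, hence also their powers. So \<bar>a\<bar> is at most \<bar>a\<bar> times such a
        power and merges with the factor \<bar>x\<bar>, at the price of the summand
        \<bar>a\<bar>.\<close>
      let ?L = "K + 1 + \<bar>a\<bar>"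
      have "(\<bar>x\<bar> - ?L) ^ Suc (degree p) \<le> \<bar>a + x * poly p x\<bar> \<and>
            \<bar>a + x * poly p x\<bar> \<le> (\<bar>x\<bar> + ?L) ^ Suc (degree p)" if x: "\<bar>x\<bar> > ?L" for x
      proof
        have *: "(\<bar>x\<bar> - K) ^ degree p \<le> \<bar>poly p x\<bar>" "\<bar>poly p x\<bar> \<le> (\<bar>x\<bar> + K) ^ degree p"
          using K[of x] x by auto
        have ge1: "1 \<le> (\<bar>x\<bar> - K) ^ degree p" "1 \<le> (\<bar>x\<bar> + K) ^ degree p"
          using x \<open>K \<ge> 0\<close> abs_ge_zero[of a] by (intro one_le_power; linarith)+
        have "(\<bar>x\<bar> - ?L) ^ Suc (degree p) \<le> (\<bar>x\<bar> - \<bar>a\<bar>) * (\<bar>x\<bar> - K) ^ degree p"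
          unfolding power_Suc using x \<open>K \<ge> 0\<close> by (intro mult_mono power_mono) auto
        also have "\<dots> \<le> \<bar>x\<bar> * (\<bar>x\<bar> - K) ^ degree p - \<bar>a\<bar>"
          using mult_left_mono[OF ge1(1), of "\<bar>a\<bar>"] by (simp add: algebra_simps)
        also have "\<dots> \<le> \<bar>x * poly p x\<bar> - \<bar>a\<bar>"
          using mult_left_mono[OF *(1), of "\<bar>x\<bar>"] by (simp add: abs_mult)
        also have "\<dots> \<le> \<bar>a + x * poly p x\<bar>"
          using abs_triangle_ineq2[of "x * poly p x" "- a"] by (simp add: add.commute)
        finally show "(\<bar>x\<bar> - ?L) ^ Suc (degree p) \<le> \<bar>a + x * poly p x\<bar>" .
        have "\<bar>a + x * poly p x\<bar> \<le> \<bar>a\<bar> + \<bar>x\<bar> * \<bar>poly p x\<bar>"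
          using abs_triangle_ineq[of a "x * poly p x"] by (simp add: abs_mult)
        also have "\<dots> \<le> \<bar>a\<bar> * (\<bar>x\<bar> + K) ^ degree p + \<bar>x\<bar> * (\<bar>x\<bar> + K) ^ degree p"
          using mult_left_mono[OF ge1(2), of "\<bar>a\<bar>"] mult_left_mono[OF *(2), of "\<bar>x\<bar>"] by simp
        also have "\<dots> = (\<bar>x\<bar> + \<bar>a\<bar>) * (\<bar>x\<bar> + K) ^ degree p"
          by (simp add: algebra_simps)
        also have "\<dots> \<le> (\<bar>x\<bar> + ?L) ^ Suc (degree p)"
          unfolding power_Suc using \<open>K \<ge> 0\<close> by (intro mult_mono power_mono) auto
        finally show "\<bar>a + x * poly p x\<bar> \<le> (\<bar>x\<bar> + ?L) ^ Suc (degree p)" .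
      qed
      with False \<open>K \<ge> 0\<close> show ?thesis
        by (intro exI[of _ ?L]) simp
    qed
  qed
  with that show thesis by blast
qed

text \<open>The lower bound for one side and the upper bound for the other compare two powers with
  the same exponent. This exponent is positive, so roots can be taken; doing it in both directions
  bounds the difference by the sum of the two constants.\<close>

lemma monic_eq_close:
  fixes f g :: "'a::linordered_idom poly"
  assumes "lead_coeff f = 1" "lead_coeff g = 1" "degree f = degree g" "degree f > 0"
  obtains K where "\<And>x y. poly g y = poly f x \<Longrightarrow> \<bar>x\<bar> > K \<Longrightarrow> \<bar>y\<bar> > K \<Longrightarrow> \<bar>\<bar>x\<bar> - \<bar>y\<bar>\<bar> \<le> K"
proof -
  obtain n where n: "degree f = Suc n"
    using assms(4) gr0_implies_Suc by blast
  obtain A where A: "A \<ge> 0" "\<And>x. \<bar>x\<bar> > A \<Longrightarrow>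
      (\<bar>x\<bar> - A) ^ degree f \<le> \<bar>poly f x\<bar> \<and> \<bar>poly f x\<bar> \<le> (\<bar>x\<bar> + A) ^ degree f"
    using monic_poly_bounds[OF assms(1)] by blast
  obtain B where B: "B \<ge> 0" "\<And>x. \<bar>x\<bar> > B \<Longrightarrow>
      (\<bar>x\<bar> - B) ^ degree f \<le> \<bar>poly g x\<bar> \<and> \<bar>poly g x\<bar> \<le> (\<bar>x\<bar> + B) ^ degree f"
    using monic_poly_bounds[OF assms(2)] assms(3) by metis
  have "\<bar>\<bar>x\<bar> - \<bar>y\<bar>\<bar> \<le> A + B"
    if eq: "poly g y = poly f x" and x: "\<bar>x\<bar> > A + B" and y: "\<bar>y\<bar> > A + B" for x y
  proof -
    have large: "\<bar>x\<bar> > A" "\<bar>y\<bar> > B"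
      using x y A(1) B(1) by linarith+
    have "(\<bar>x\<bar> - A) ^ degree f \<le> (\<bar>y\<bar> + B) ^ degree f"
      using A(2)[OF large(1)] B(2)[OF large(2)] eq by (metis order_trans)
    then have "\<bar>x\<bar> - A \<le> \<bar>y\<bar> + B"
      unfolding n by (rule power_le_imp_le_base) (use B(1) in simp)
    moreover have "(\<bar>y\<bar> - B) ^ degree f \<le> (\<bar>x\<bar> + A) ^ degree f"
      using A(2)[OF large(1)] B(2)[OF large(2)] eq by (metis order_trans)
    then have "\<bar>y\<bar> - B \<le> \<bar>x\<bar> + A"
      unfolding n by (rule power_le_imp_le_base) (use A(1) in simp)
    ultimately show ?thesis
      by (auto simp: abs_le_iff algebra_simps)
  qed
  with that show thesis by blast
qed

text \<open>The two sides are different polynomials because they differ at \<open>z\<close>: for s =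
  \<plusminus>1 the product has only integer roots, whereas \<open>z\<close> is a non-integral root
  of \<open>f\<close>. Their difference is taken over the complex numbers, where \<open>z\<close>
  lives, and the integer solutions embed into its finite root set.\<close>

lemma finite_solutions_on_line:
  fixes f :: "int poly" and q :: "'i \<Rightarrow> int" and z :: complex
  assumes "finite I" and root: "poly (map_poly of_int f) z = 0" and z: "z \<notin> \<int>"
    and s: "s = 1 \<or> s = -1"
  shows "finite {x. (\<Prod>i\<in>I. s * x + d + q i) = poly f x}"
proof -
  define g :: "complex poly" where "g = (\<Prod>i\<in>I. [:of_int (d + q i), of_int s:])"
  have "of_int (d + q i) + z * of_int s \<noteq> 0" for i
  proof
    assume "of_int (d + q i) + z * of_int s = 0"
    then have *: "z * of_int s = of_int (- (d + q i))"
      unfolding of_int_minus by (simp only: eq_neg_iff_add_eq_0 add.commute)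
    \<comment> \<open>As \<open>s\<close> is its own inverse, dividing by it stays within the
      integers.\<close>
    have "z = z * of_int s * of_int s"
      using s by auto
    also have "\<dots> = of_int (- (d + q i) * s)"
      unfolding * by simp
    finally have "z = of_int (- (d + q i) * s)" .
    with z show False
      by (metis Ints_of_int)
  qed
  then have "poly g z \<noteq> 0"
    using \<open>finite I\<close> by (simp add: g_def poly_prod)
  with root have "g - map_poly of_int f \<noteq> 0"
    by auto
  then have "finite {w. poly (g - map_poly of_int f) w = 0}"
    by (rule poly_roots_finite)
  then have "finite (of_int -` {w. poly (g - map_poly of_int f) w = 0} :: int set)"
    by (rule finite_vimageI) (simp add: inj_on_def)
  moreover have "{x. (\<Prod>i\<in>I. s * x + d + q i) = poly f x}
      \<subseteq> of_int -` {w. poly (g - map_poly of_int f) w = 0}"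
  proof
    fix x assume "x \<in> {x. (\<Prod>i\<in>I. s * x + d + q i) = poly f x}"
    then have "of_int (\<Prod>i\<in>I. s * x + d + q i) = (of_int (poly f x) :: complex)"
      by simp
    then show "x \<in> of_int -` {w. poly (g - map_poly of_int f) w = 0}"
      by (simp add: g_def poly_prod poly_map_poly_of_int algebra_simps)
  qed
  ultimately show ?thesis
    by (rule finite_subset[rotated])
qed

theorem theorem1p2:
  fixes f :: "int poly" and m :: nat and q :: "nat \<Rightarrow> int"
  assumes "lead_coeff f = 1"
    and "degree f = m"
    and "\<exists>z::complex. poly (map_poly of_int f) z = 0 \<and> z \<notin> \<int>"
  shows "finite {(x::int, y::int). (\<Prod>i=1..m. (y + q i)) = poly f x}"
proof -
  from assms(3) obtain z :: complex where z: "poly (map_poly of_int f) z = 0" "z \<notin> \<int>"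
    by blast
  \<comment> \<open>A constant monic polynomial is 1 and has no root \<open>z\<close>.\<close>
  have "m > 0"
  proof (rule ccontr)
    assume "\<not> m > 0"
    with assms(1,2) have "f = 1"
      by (metis degree_eq_zeroE lead_coeff_pCons(2) neq0_conv one_pCons pCons_0_0 pCons_one)
    with z(1) show False by simp
  qed
  define g :: "int poly" where "g = (\<Prod>i=1..m. [:q i, 1:])"
  have g: "poly g y = (\<Prod>i=1..m. (y + q i))" for y
    by (simp add: g_def poly_prod add.commute)
  have "lead_coeff g = 1"
    by (simp add: g_def lead_coeff_prod)
  moreover have "degree g = m"
    by (simp add: g_def degree_prod_sum_eq)
  ultimately obtain K where
      K: "\<And>x y. poly g y = poly f x \<Longrightarrow> \<bar>x\<bar> > K \<Longrightarrow> \<bar>y\<bar> > K \<Longrightarrow> \<bar>\<bar>x\<bar> - \<bar>y\<bar>\<bar> \<le> K"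
    using monic_eq_close[of f g] assms(1,2) \<open>m > 0\<close> by auto
  define L where "L s d = {x. (\<Prod>i=1..m. s * x + d + q i) = poly f x}" for s d :: int
  \<comment> \<open>If one coordinate is at most \<open>K\<close> in absolute value, it takes
    finitely many values, and each leaves finitely many values for the other, as \<open>f\<close>
    and \<open>g\<close> are nonconstant. The remaining solutions lie on finitely many
    lines.\<close>
  have "{(x, y). (\<Prod>i=1..m. (y + q i)) = poly f x} \<subseteq>
      (SIGMA x:{-K..K}. {y. poly g y = poly f x}) \<union>
      (\<Union>y\<in>{-K..K}. {x. poly f x = poly g y} \<times> {y}) \<union>
      (\<Union>s\<in>{1, -1}. \<Union>d\<in>{-K..K}. (\<lambda>x. (x, s * x + d)) ` L s d)" (is "_ \<subseteq> ?A \<union> ?B \<union> ?C")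
  proof
    fix w assume "w \<in> {(x, y). (\<Prod>i=1..m. (y + q i)) = poly f x}"
    then obtain x y where w: "w = (x, y)" and eq: "(\<Prod>i=1..m. (y + q i)) = poly f x"
      by blast
    show "w \<in> ?A \<union> ?B \<union> ?C"
    proof (cases "\<bar>x\<bar> > K \<and> \<bar>y\<bar> > K")
      case True
      with K eq g have "\<bar>\<bar>x\<bar> - \<bar>y\<bar>\<bar> \<le> K"
        by simp
      \<comment> \<open>\<bar>\<bar>x\<bar> - \<bar>y\<bar>\<bar> is the smaller of \<bar>y -
        x\<bar> and \<bar>y + x\<bar>; these are the offsets for slope 1 and slope -1.\<close>
      then have "y - x \<in> {-K..K} \<or> y + x \<in> {-K..K}"
        by auto
      moreover have "x \<in> L 1 (y - x)" "x \<in> L (-1) (y + x)"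
        using eq by (simp_all add: L_def)
      ultimately have "(x, y) \<in> ?C"
        by (auto intro: bexI[of _ "y - x"] bexI[of _ "y + x"])
      with w show ?thesis by blast
    next
      case False
      with eq have "(x, y) \<in> ?A \<or> (x, y) \<in> ?B"
        by (auto simp: g)
      with w show ?thesis by blast
    qed
  qed
  moreover have "finite (L s d)" if "s \<in> {1, -1}" for s d
    unfolding L_def using that by (intro finite_solutions_on_line[OF _ z]) auto
  then have "finite (?A \<union> ?B \<union> ?C)"
    using finite_poly_eq[of f] finite_poly_eq[of g] \<open>degree g = m\<close> assms(2) \<open>m > 0\<close>
    by (intro finite_UnI finite_SigmaI finite_UN_I finite_imageI) auto
  ultimately show ?thesis
    by (rule finite_subset)
qed

end
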